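(* Let $W>H>0$, and let $v_{\max},B,P_t,\lambda,\sigma^2,r_{\mathrm{UE}}^{\min},\alpha_x$ be positive reals. Put $t_0=H/v_{\max}$ and $t_1=W/v_{\max}$. Consider the single-UAV scenario with a static user described in the context, with its two candidate trajectories $\mathcal T_x$ and $\mathcal T_y$ over $[0,t_1]$; let $\mathcal T_{\mathrm{ttc}}$ be the one that minimizes the connection time and $\mathcal T_{\mathrm{dat}}$ the one that maximizes the transferred data. Let $$\alpha_{\mathrm{ttc}}=\frac{10}{\sqrt{(H-W)^2+H^2}}\log_{10}\!\left(\frac{P_t\lambda^2\,(2^{r_{\mathrm{UE}}^{\min}/B}-1)^{-1}}{16\pi^2\sigma^2\,((H-W)^2+H^2)}\right)$$ and $$\alpha_{\mathrm{dat}}=\frac1{\check D}\left(B\log_2\!\Big(\frac{P_t\lambda^2}{16\pi^2\sigma^2}\Big)\frac{W}{v_{\max}}-B\log_2\!\Big(1+\frac{P_t\lambda^2}{16\pi^2\sigma^2W^2}\Big)\frac{W-H}{v_{\max}}-\hat D\right),$$ where $$\check D=B\,\frac{\log_2 10}{20\,v_{\max}}\left(W\sqrt{W^2+H^2}+H^2\tanh^{-1}\!\Big(\frac{W}{\sqrt{W^2+H^2}}\Big)\right),$$ $$\hat D=B t_1\log_2(W^2+H^2)-2Bt_1\log_2 e+2Bt_0\,(\log_2 e)\tan^{-1}\!\Big(\frac WH\Big).$$ If $$r_{\mathrm{UE}}^{\min}\le B\log_2\!\left(1+\frac{P_t\lambda^2}{16\pi^2\sigma^2W^2}\right)\quad\text{and}\quad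 \alpha_{\mathrm{ttc}}<\alpha_x<\alpha_{\mathrm{dat}},$$ then $\mathcal T_{\mathrm{ttc}}=\mathcal T_y$ and $\mathcal T_{\mathrm{dat}}=\mathcal T_x$.
   Context: Scenario. A base station is at $[0,0]^\top$ and a static user at $q_{\mathrm{UE}}=[W,H]^\top$, at opposite corners of a building whose floor plan is $[\epsilon W,W-\epsilon W]\times[\epsilon H,H-\epsilon H]$ with $\epsilon>0$ arbitrarily small (the limit $\epsilon\to0$ is taken in the rates below). A single UAV at height $0$ flies with speed $v_{\max}$ starting at $[0,0]^\top$; $q(t)\in\mathbb R^2$ is its position at time $t$. The building absorption is $\alpha_y=+\infty$ dB/m where $Wy\ge Hx$ and $\alpha_x$ dB/m where $Wy<Hx$. The link from the base station to the UAV is never the bottleneck, so the user rate equals the rate of the UAV-user link: with $d(t)=\|q(t)-q_{\mathrm{UE}}\|$ and absorption $\alpha$ along the link, $$r_{\mathrm{UE}}(\alpha,t)=B\log_2\!\left(1+\frac{P_t\lambda^2}{16\pi^2\sigma^2\,d(t)^2\,10^{\alpha d(t)/10}}\right),\qquad r_{\mathrm{UE}}(+\infty,t)=0.$$ Candidate trajectories on $[0,t_1]$. - $\mathcal T_x$: $q(t)=[v_{\max}t,0]^\top$ for $t\in[0,t_1]$; the absorption is $\alpha=\alpha_x$, so the user rate is $r_{\mathrm{UE}}(\alpha_x,t)$ for $t\in[0,t_1]$. - $\mathcal T_y$: $q(t)=[0,v_{\max}t]^\top$ for $t\in[0,t_0)$ and $q(t)=[0,H]^\top$ for $t\in[t_0,t_1]$;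 the absorption is $+\infty$ on $[0,t_0)$ (user rate $0$) and $0$ on $[t_0,t_1]$ (user rate $r_{\mathrm{UE}}(0,t)$). The connection time of a trajectory is the infimum of the times $t$ at which the user rate is at least $r_{\mathrm{UE}}^{\min}$ ($+\infty$ if there is none). The transferred data is the integral of the user rate over $[0,t_1]$. *)

theory Defs
  imports "HOL-Analysis.Analysis"
begin

text \<open>
  A candidate trajectory records the UAV position together with the absorption (in dB/m,
  possibly infinite) along the link from the UAV to the user.  The absorption profiles are those
  obtained when the margin \<open>\<epsilon>\<close> between the building and the corners of the area tends to 0.
\<close>

record trajectory =
  position :: "real \<Rightarrow> real^2"
  absorption :: "real \<Rightarrow> ereal"

definition user_position :: "real \<Rightarrow> real \<Rightarrow> real^2" where
  "user_position W H = vector [W, H]"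

definition traj_x :: "real \<Rightarrow> real \<Rightarrow> trajectory" where
  "traj_x vmax \<alpha>x =
    \<lparr> position = (\<lambda>t. vector [vmax * t, 0]),
      absorption = (\<lambda>t. ereal \<alpha>x) \<rparr>"

definition traj_y :: "real \<Rightarrow> real \<Rightarrow> trajectory" where
  "traj_y vmax H =
    \<lparr> position = (\<lambda>t. if t < H / vmax then vector [0, vmax * t] else vector [0, H]),
      absorption = (\<lambda>t. if t < H / vmax then \<infinity> else 0) \<rparr>"

text \<open>
  Throughout, \<open>lam\<close> is the wavelength and \<open>sigmasq\<close> is the noise power \<open>\<sigma>\<^sup>2\<close>.
\<close>

definition link_rate :: "real \<Rightarrow> real \<Rightarrow> real \<Rightarrow> real \<Rightarrow> ereal \<Rightarrow> real \<Rightarrow> real" where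
  "link_rate B Pt lam sigmasq \<alpha> d =
    (if \<alpha> = \<infinity> then 0
     else B * log 2 (1 + Pt * lam\<^sup>2 /
            (16 * pi\<^sup>2 * sigmasq * d\<^sup>2 * 10 powr (real_of_ereal \<alpha> * d / 10))))"

definition user_rate ::
    "real \<Rightarrow> real \<Rightarrow> real \<Rightarrow> real \<Rightarrow> real \<Rightarrow> real \<Rightarrow> trajectory \<Rightarrow> real \<Rightarrow> real" where
  "user_rate W H B Pt lam sigmasq T t =
    link_rate B Pt lam sigmasq (absorption T t) (norm (position T t - user_position W H))"

text \<open>The infimum is taken in \<^typ>\<open>ereal\<close>, so it is \<open>\<infinity>\<close> if the required rate is never reached.\<close>

definition connection_time :: "real \<Rightarrow> real \<Rightarrow> (real \<Rightarrow> real) \<Rightarrow> ereal" where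
  "connection_time t1 rmin r = (INF t\<in>{t \<in> {0..t1}. rmin \<le> r t}. ereal t)"

definition transferred_data :: "real \<Rightarrow> (real \<Rightarrow> real) \<Rightarrow> real" where
  "transferred_data t1 r = integral {0..t1} r"

definition alpha_ttc ::
    "real \<Rightarrow> real \<Rightarrow> real \<Rightarrow> real \<Rightarrow> real \<Rightarrow> real \<Rightarrow> real \<Rightarrow> real" where
  "alpha_ttc W H B Pt lam sigmasq rmin =
    10 / sqrt ((H - W)\<^sup>2 + H\<^sup>2) *
      log 10 (Pt * lam\<^sup>2 * inverse (2 powr (rmin / B) - 1) /
        (16 * pi\<^sup>2 * sigmasq * ((H - W)\<^sup>2 + H\<^sup>2)))"

definition D_check :: "real \<Rightarrow> real \<Rightarrow> real \<Rightarrow> real \<Rightarrow> real" where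
  "D_check W H vmax B =
    B * (log 2 10 / (20 * vmax)) *
      (W * sqrt (W\<^sup>2 + H\<^sup>2) + H\<^sup>2 * artanh (W / sqrt (W\<^sup>2 + H\<^sup>2)))"

definition D_hat :: "real \<Rightarrow> real \<Rightarrow> real \<Rightarrow> real \<Rightarrow> real" where
  "D_hat W H vmax B =
    B * (W / vmax) * log 2 (W\<^sup>2 + H\<^sup>2) - 2 * B * (W / vmax) * log 2 (exp 1)
      + 2 * B * (H / vmax) * log 2 (exp 1) * arctan (W / H)"

definition alpha_dat ::
    "real \<Rightarrow> real \<Rightarrow> real \<Rightarrow> real \<Rightarrow> real \<Rightarrow> real \<Rightarrow> real \<Rightarrow> real" where
  "alpha_dat W H vmax B Pt lam sigmasq =
    1 / D_check W H vmax B *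
      (B * log 2 (Pt * lam\<^sup>2 / (16 * pi\<^sup>2 * sigmasq)) * (W / vmax)
       - B * log 2 (1 + Pt * lam\<^sup>2 / (16 * pi\<^sup>2 * sigmasq * W\<^sup>2)) * ((W - H) / vmax)
       - D_hat W H vmax B)"

end

theory Submission
  imports Defs
begin

text \<open>
  \<^bold>\<open>Connection time.\<close> Along \<open>traj_y\<close> the rate is 0 before \<open>H / vmax\<close>; from then on it is the
  free-space rate at distance \<open>W\<close>, which suffices by hypothesis, so the connection time is exactly
  \<open>H / vmax\<close>.  Along \<open>traj_x\<close> the UAV approaches the user all the time, so its rate increases.
  The bound \<open>alpha_ttc\<close> is the absorption for which that rate equals \<open>rmin\<close> at the instant
  \<open>H / vmax\<close> (lemma \<open>link_rate_less_iff\<close>).  For a larger absorption the rate is still below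
  \<open>rmin\<close> at that instant and, by continuity, shortly afterwards, so the connection along \<open>traj_x\<close>
  comes strictly later or never.

  \<^bold>\<open>Transferred data.\<close> Dropping the summand 1 in \<open>log 2 (1 + SNR)\<close> bounds the rate along
  \<open>traj_x\<close> from below by \<open>B * log 2 SNR\<close>.  With the distance \<open>sqrt (u\<^sup>2 + H\<^sup>2)\<close>, where
  \<open>u = W - vmax * t\<close>, the bound splits into a constant, a multiple of \<open>ln (u\<^sup>2 + H\<^sup>2)\<close> and a
  multiple of \<open>\<alpha>x * sqrt (u\<^sup>2 + H\<^sup>2)\<close>.  All three have elementary primitives; the last two
  contribute \<open>- D_hat\<close> and \<open>- \<alpha>x * D_check\<close> to the integral.  The result is an affine function
  of \<open>\<alpha>x\<close> with slope \<open>- D_check\<close>, and \<open>alpha_dat\<close> is where it meets the amount transferred along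
  \<open>traj_y\<close>; below \<open>alpha_dat\<close> the trajectory \<open>traj_x\<close> transfers more.
\<close>

section \<open>The rate of a link as a function of its length\<close>

lemma link_rate_ereal:
  "link_rate B Pt lam sigmasq (ereal \<alpha>) d =
     B * log 2 (1 + Pt * lam\<^sup>2 / (16 * pi\<^sup>2 * sigmasq * d\<^sup>2 * 10 powr (\<alpha> * d / 10)))"
  by (simp add: link_rate_def)

lemma link_rate_antimono:
  assumes "B > 0" "Pt > 0" "lam > 0" "sigmasq > 0" "\<alpha> \<ge> 0" "0 < d" "d \<le> d'"
  shows "link_rate B Pt lam sigmasq (ereal \<alpha>) d' \<le> link_rate B Pt lam sigmasq (ereal \<alpha>) d"
proof -
  have "d\<^sup>2 * 10 powr (\<alpha> * d / 10) \<le> d'\<^sup>2 * 10 powr (\<alpha> * d' / 10)"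
    using assms by (intro mult_mono power_mono powr_mono divide_right_mono mult_left_mono) auto
  then have "16 * pi\<^sup>2 * sigmasq * d\<^sup>2 * 10 powr (\<alpha> * d / 10)
      \<le> 16 * pi\<^sup>2 * sigmasq * d'\<^sup>2 * 10 powr (\<alpha> * d' / 10)"
    using assms by (simp add: mult.assoc)
  then have "Pt * lam\<^sup>2 / (16 * pi\<^sup>2 * sigmasq * d'\<^sup>2 * 10 powr (\<alpha> * d' / 10))
      \<le> Pt * lam\<^sup>2 / (16 * pi\<^sup>2 * sigmasq * d\<^sup>2 * 10 powr (\<alpha> * d / 10))"
    using assms by (intro divide_left_mono) (auto intro!: mult_pos_pos)
  moreover have "Pt * lam\<^sup>2 / (16 * pi\<^sup>2 * sigmasq * d'\<^sup>2 * 10 powr (\<alpha> * d' / 10)) > 0"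
    using assms by simp
  moreover have "log 2 (1 + a) \<le> log 2 (1 + b)" if "0 < a" "a \<le> b" for a b :: real
    using that by (subst log_le_cancel_iff) auto
  ultimately show ?thesis
    using assms(1) unfolding link_rate_ereal by (intro mult_left_mono) auto
qed

lemma continuous_on_link_rate:
  assumes "Pt > 0" "lam > 0" "sigmasq > 0"
  shows "continuous_on {0<..} (link_rate B Pt lam sigmasq (ereal \<alpha>))"
proof -
  have "1 + Pt * lam\<^sup>2 / (16 * pi\<^sup>2 * sigmasq * d\<^sup>2 * 10 powr (\<alpha> * d / 10)) > 0" if "d > 0" for d
    using assms that by (intro add_pos_pos divide_pos_pos mult_pos_pos) auto
  then show ?thesis
    unfolding link_rate_ereal using assms
    by (intro continuous_intros) (auto simp: less_imp_neq[symmetric])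
qed

text \<open>
  Solving \<open>rate = r\<close> for the absorption: the rate decreases in \<open>\<alpha>\<close>, and the right-hand side has
  the shape of \<open>alpha_ttc\<close>.
\<close>

lemma link_rate_less_iff:
  assumes "B > 0" "Pt > 0" "lam > 0" "sigmasq > 0" "r > 0" "d > 0"
  shows "link_rate B Pt lam sigmasq (ereal \<alpha>) d < r \<longleftrightarrow>
    10 / d * log 10 (Pt * lam\<^sup>2 * inverse (2 powr (r / B) - 1) / (16 * pi\<^sup>2 * sigmasq * d\<^sup>2)) < \<alpha>"
proof -
  define M where "M = Pt * lam\<^sup>2 / (16 * pi\<^sup>2 * sigmasq * d\<^sup>2)"
  define g where "g = 2 powr (r / B) - 1"
  define p where "p = 10 powr (\<alpha> * d / 10)"
  have M: "M > 0" using assms by (simp add: M_def)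
  have "2 powr (r / B) > 2 powr 0" using assms by (intro powr_less_mono) auto
  then have g: "g > 0" by (simp add: g_def)
  have p: "p > 0" by (simp add: p_def)
  have "link_rate B Pt lam sigmasq (ereal \<alpha>) d < r \<longleftrightarrow> log 2 (1 + M / p) < r / B"
    using assms by (simp add: link_rate_ereal M_def p_def pos_less_divide_eq mult.commute)
  also have "\<dots> \<longleftrightarrow> M / p < g"
    using M p by (subst log_less_iff) (auto simp: g_def add_pos_pos)
  also have "\<dots> \<longleftrightarrow> M * inverse g < p"
    using g p by (simp add: field_simps)
  also have "\<dots> \<longleftrightarrow> log 10 (M * inverse g) < \<alpha> * d / 10"
    unfolding p_def using M g by (subst log_less_iff) auto
  also have "\<dots> \<longleftrightarrow> 10 / d * log 10 (M * inverse g) < \<alpha>"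
    using assms by (simp add: field_simps)
  also have "M * inverse g = Pt * lam\<^sup>2 * inverse g / (16 * pi\<^sup>2 * sigmasq * d\<^sup>2)"
    by (simp add: M_def)
  finally show ?thesis by (simp add: g_def)
qed

text \<open>
  Dropping the summand 1 inside the logarithm separates the constants, the free-space loss
  \<open>ln (d\<^sup>2)\<close> and the absorption loss, which is linear in \<open>d\<close>; unlike the rate itself, this bound
  can be integrated in closed form along a straight line.
\<close>

lemma link_rate_ge_log_snr:
  assumes "B > 0" "Pt > 0" "lam > 0" "sigmasq > 0" "d > 0"
  shows "B * (ln (Pt * lam\<^sup>2 / (16 * pi\<^sup>2 * sigmasq)) - ln (d\<^sup>2) - \<alpha> * ln 10 / 10 * d) / ln 2
    \<le> link_rate B Pt lam sigmasq (ereal \<alpha>) d"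
proof -
  define K where "K = Pt * lam\<^sup>2 / (16 * pi\<^sup>2 * sigmasq)"
  define p where "p = 10 powr (\<alpha> * d / 10)"
  have K: "K > 0" and p: "p > 0" using assms by (auto simp: K_def p_def)
  have snr: "Pt * lam\<^sup>2 / (16 * pi\<^sup>2 * sigmasq * d\<^sup>2 * p) = K / (d\<^sup>2 * p)"
    by (simp add: K_def mult.assoc)
  have "ln K - ln (d\<^sup>2) - \<alpha> * ln 10 / 10 * d = ln (K / (d\<^sup>2 * p))"
    using K p assms by (simp add: ln_div ln_mult, simp add: p_def ln_powr)
  also have "\<dots> \<le> ln (1 + K / (d\<^sup>2 * p))"
    using K p assms by (subst ln_le_cancel_iff) (auto intro: add_pos_pos)
  finally have "(ln K - ln (d\<^sup>2) - \<alpha> * ln 10 / 10 * d) / ln 2 \<le> log 2 (1 + K / (d\<^sup>2 * p))"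
    unfolding log_def by (intro divide_right_mono) auto
  then have "B * ((ln K - ln (d\<^sup>2) - \<alpha> * ln 10 / 10 * d) / ln 2) \<le> B * log 2 (1 + K / (d\<^sup>2 * p))"
    using assms by (intro mult_left_mono) auto
  then show ?thesis
    unfolding link_rate_ereal p_def[symmetric] snr K_def[symmetric] by simp
qed

section \<open>The rates along the two trajectories\<close>

lemma norm_diff_vector_2:
  "norm (vector [x, y] - vector [a, b] :: real^2) = sqrt ((x - a)\<^sup>2 + (y - b)\<^sup>2)"
  by (simp add: norm_vec_def L2_set_def UNIV_2)

lemma user_rate_traj_x:
  "user_rate W H B Pt lam sigmasq (traj_x vmax \<alpha>) t =
     link_rate B Pt lam sigmasq (ereal \<alpha>) (sqrt ((W - vmax * t)\<^sup>2 + H\<^sup>2))"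
  by (simp add: user_rate_def traj_x_def user_position_def norm_diff_vector_2
      power2_commute[of "vmax * t"])

lemma user_rate_traj_y:
  assumes "W > 0"
  shows "user_rate W H B Pt lam sigmasq (traj_y vmax H) t =
    (if t < H / vmax then 0 else B * log 2 (1 + Pt * lam\<^sup>2 / (16 * pi\<^sup>2 * sigmasq * W\<^sup>2)))"
  using assms
  by (simp add: user_rate_def traj_y_def user_position_def norm_diff_vector_2 link_rate_def)

lemma continuous_on_user_rate_traj_x:
  assumes "Pt > 0" "lam > 0" "sigmasq > 0" "H > 0"
  shows "continuous_on S (user_rate W H B Pt lam sigmasq (traj_x vmax \<alpha>))"
proof -
  have "continuous_on S (link_rate B Pt lam sigmasq (ereal \<alpha>) \<circ> (\<lambda>t. sqrt ((W - vmax * t)\<^sup>2 + H\<^sup>2)))"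
  proof (rule continuous_on_compose)
    show "continuous_on S (\<lambda>t. sqrt ((W - vmax * t)\<^sup>2 + H\<^sup>2))"
      by (intro continuous_intros)
    show "continuous_on ((\<lambda>t. sqrt ((W - vmax * t)\<^sup>2 + H\<^sup>2)) ` S)
        (link_rate B Pt lam sigmasq (ereal \<alpha>))"
      by (rule continuous_on_subset[OF continuous_on_link_rate])
        (use assms in \<open>auto intro!: add_nonneg_pos\<close>)
  qed
  then show ?thesis by (simp add: user_rate_traj_x o_def)
qed

lemma user_rate_traj_x_mono:
  assumes "B > 0" "Pt > 0" "lam > 0" "sigmasq > 0" "\<alpha> \<ge> 0" "H > 0" "vmax > 0"
    and "s \<le> t" "t \<le> W / vmax"
  shows "user_rate W H B Pt lam sigmasq (traj_x vmax \<alpha>) s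
    \<le> user_rate W H B Pt lam sigmasq (traj_x vmax \<alpha>) t"
proof -
  have "vmax * s \<le> vmax * t" "vmax * t \<le> W"
    using assms by (auto simp: field_simps)
  then have "sqrt ((W - vmax * t)\<^sup>2 + H\<^sup>2) \<le> sqrt ((W - vmax * s)\<^sup>2 + H\<^sup>2)"
    by (intro real_sqrt_le_mono add_right_mono power_mono) auto
  moreover have "sqrt ((W - vmax * t)\<^sup>2 + H\<^sup>2) > 0"
    using assms by (auto intro!: add_nonneg_pos)
  ultimately show ?thesis
    unfolding user_rate_traj_x using assms by (intro link_rate_antimono) auto
qed

section \<open>Connection times\<close>

lemma connection_time_traj_y:
  assumes "W > H" "H > 0" "vmax > 0" "rmin > 0"
    and "rmin \<le> B * log 2 (1 + Pt * lam\<^sup>2 / (16 * pi\<^sup>2 * sigmasq * W\<^sup>2))"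
  shows "connection_time (W / vmax) rmin (user_rate W H B Pt lam sigmasq (traj_y vmax H))
    = ereal (H / vmax)"
proof -
  have "{t \<in> {0..W / vmax}. rmin \<le> user_rate W H B Pt lam sigmasq (traj_y vmax H) t}
      = {H / vmax..W / vmax}"
    using assms by (auto simp: user_rate_traj_y intro: order_trans[of 0 "H / vmax"])
  moreover have "H / vmax \<le> W / vmax"
    using assms by (simp add: divide_right_mono)
  ultimately show ?thesis
    unfolding connection_time_def by (auto intro!: INF_eqI)
qed

text \<open>
  The infimum defining the connection time need not be attained, so a rate below the threshold at
  time \<open>t0\<close> alone gives only the weak inequality; continuity provides the strict one.
\<close>

lemma connection_time_greater:
  fixes f :: "real \<Rightarrow> real"
  assumes "isCont f t0" "f t0 < rmin" "t0 < t1"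
    and mono: "\<And>s t. s \<le> t \<Longrightarrow> t \<le> t1 \<Longrightarrow> f s \<le> f t"
  shows "ereal t0 < connection_time t1 rmin f"
proof -
  have "eventually (\<lambda>t. f t < rmin) (at_right t0)"
    using assms(1,2) by (auto simp: isCont_def intro: order_tendstoD filterlim_at_within_not_equal
        elim: filterlim_mono[OF _ order_refl at_le[OF subset_UNIV]])
  then obtain b where b: "b > t0" "\<And>t. t0 < t \<Longrightarrow> t < b \<Longrightarrow> f t < rmin"
    by (auto simp: eventually_at_right_field)
  define s where "s = (t0 + min b t1) / 2"
  have s: "t0 < s" "s < b" "s < t1" using b(1) assms(3) by (auto simp: s_def min_def)
  have "ereal s \<le> connection_time t1 rmin f"
    unfolding connection_time_def
  proof (rule INF_greatest)
    fix t assume "t \<in> {t \<in> {0..t1}. rmin \<le> f t}"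
    then have "f s < f t" using b(2)[OF s(1,2)] by auto
    then have "s < t" using mono[of t s] s(3) by (cases "t \<le> s") auto
    then show "ereal s \<le> ereal t" by simp
  qed
  then show ?thesis using s(1) less_le_trans[of "ereal t0" "ereal s"] by simp
qed

section \<open>Transferred data\<close>

lemma transferred_data_traj_y:
  assumes "W > H" "H > 0" "vmax > 0"
  shows "transferred_data (W / vmax) (user_rate W H B Pt lam sigmasq (traj_y vmax H))
    = B * log 2 (1 + Pt * lam\<^sup>2 / (16 * pi\<^sup>2 * sigmasq * W\<^sup>2)) * ((W - H) / vmax)"
proof -
  define c where "c = B * log 2 (1 + Pt * lam\<^sup>2 / (16 * pi\<^sup>2 * sigmasq * W\<^sup>2))"
  have le: "H / vmax \<le> W / vmax" "0 \<le> H / vmax"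
    using assms by (auto simp: divide_right_mono)
  have "((\<lambda>t. c) has_integral c * ((W - H) / vmax)) {H / vmax..W / vmax}"
    using has_integral_const_real[of c "H / vmax" "W / vmax"] le
    by (simp add: diff_divide_distrib mult.commute)
  then have "((\<lambda>t. if t \<in> {H / vmax..W / vmax} then c else 0) has_integral c * ((W - H) / vmax))
      {0..W / vmax}"
    using le by (subst has_integral_restrict) auto
  then have "(user_rate W H B Pt lam sigmasq (traj_y vmax H) has_integral c * ((W - H) / vmax))
      {0..W / vmax}"
    by (rule has_integral_eq[rotated]) (use assms in \<open>auto simp: user_rate_traj_y c_def\<close>)
  then show ?thesis
    unfolding transferred_data_def c_def by (rule integral_unique)
qed

lemma DERIV_primitive_ln_sum_squares:
  fixes H u :: real
  assumes "H > 0"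
  shows "((\<lambda>u. u * ln (u\<^sup>2 + H\<^sup>2) - 2 * u + 2 * H * arctan (u / H)) has_real_derivative
    ln (u\<^sup>2 + H\<^sup>2)) (at u)"
proof -
  have pos: "u\<^sup>2 + H\<^sup>2 > 0" using assms by (intro add_nonneg_pos) auto
  have "((\<lambda>u. u * ln (u\<^sup>2 + H\<^sup>2) - 2 * u + 2 * H * arctan (u / H)) has_real_derivative
      ln (u\<^sup>2 + H\<^sup>2) + u * (2 * u / (u\<^sup>2 + H\<^sup>2)) - 2 + 2 * H * (1 / H / (1 + (u / H)\<^sup>2))) (at u)"
    using pos assms by (auto intro!: derivative_eq_intros simp: divide_inverse)
  moreover have "1 + (u / H)\<^sup>2 = (u\<^sup>2 + H\<^sup>2) / H\<^sup>2"
    using assms by (simp add: power_divide field_simps)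
  then have "2 * H * (1 / H / (1 + (u / H)\<^sup>2)) = 2 * H\<^sup>2 / (u\<^sup>2 + H\<^sup>2)"
    using assms by simp
  moreover have "u * (2 * u / (u\<^sup>2 + H\<^sup>2)) + 2 * H\<^sup>2 / (u\<^sup>2 + H\<^sup>2) = 2"
  proof -
    have "u * (2 * u / (u\<^sup>2 + H\<^sup>2)) + 2 * H\<^sup>2 / (u\<^sup>2 + H\<^sup>2) = 2 * (u\<^sup>2 + H\<^sup>2) / (u\<^sup>2 + H\<^sup>2)"
      by (simp add: add_divide_distrib power2_eq_square distrib_left)
    also have "\<dots> = 2"
      using pos by (intro nonzero_mult_div_cancel_right) linarith
    finally show ?thesis .
  qed
  ultimately show ?thesis by (simp add: algebra_simps)
qed

text \<open>
  The summand \<open>artanh (u / sqrt (u\<^sup>2 + H\<^sup>2))\<close> is \<open>arsinh (u / H)\<close> in disguise; its derivative is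
  \<open>1 / sqrt (u\<^sup>2 + H\<^sup>2)\<close>.
\<close>

lemma DERIV_primitive_sqrt_sum_squares:
  fixes H u :: real
  assumes "H > 0"
  shows "((\<lambda>u. (u * sqrt (u\<^sup>2 + H\<^sup>2) + H\<^sup>2 * artanh (u / sqrt (u\<^sup>2 + H\<^sup>2))) / 2) has_real_derivative
    sqrt (u\<^sup>2 + H\<^sup>2)) (at u)"
proof -
  define s where "s = sqrt (u\<^sup>2 + H\<^sup>2)"
  have pos: "u\<^sup>2 + H\<^sup>2 > 0" using assms by (intro add_nonneg_pos) auto
  have s: "s > 0" "s\<^sup>2 = u\<^sup>2 + H\<^sup>2" using pos by (auto simp: s_def)
  have "\<bar>u\<bar> < s"
    using assms unfolding s_def by (intro real_less_rsqrt) simp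
  then have abs: "\<bar>u / s\<bar> < 1" using s(1) by (simp add: abs_divide)
  have ds: "((\<lambda>u. sqrt (u\<^sup>2 + H\<^sup>2)) has_real_derivative u / s) (at u)"
    using pos by (auto intro!: derivative_eq_intros simp: s_def field_simps)
  have "sqrt (u\<^sup>2 + H\<^sup>2) \<noteq> 0" using s(1) unfolding s_def by linarith
  from DERIV_divide[OF DERIV_ident ds this]
  have dq: "((\<lambda>u. u / sqrt (u\<^sup>2 + H\<^sup>2)) has_real_derivative (s - u * (u / s)) / (s * s)) (at u)"
    by (simp add: s_def)
  have da: "((\<lambda>u. artanh (u / sqrt (u\<^sup>2 + H\<^sup>2))) has_real_derivative
      1 / (1 - (u / s)\<^sup>2) * ((s - u * (u / s)) / (s * s))) (at u)"
    using DERIV_chain2[OF artanh_real_has_field_derivative dq] abs by (simp add: s_def)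
  have "s - u * (u / s) = s * (1 - (u / s)\<^sup>2)"
    using s(1) by (simp add: field_simps power2_eq_square)
  moreover have "1 - (u / s)\<^sup>2 \<noteq> 0"
    using abs abs_square_less_1[of "u / s"] by linarith
  ultimately have da': "((\<lambda>u. artanh (u / sqrt (u\<^sup>2 + H\<^sup>2))) has_real_derivative 1 / s) (at u)"
    using da s(1) by simp
  have "((\<lambda>u. (u * sqrt (u\<^sup>2 + H\<^sup>2) + H\<^sup>2 * artanh (u / sqrt (u\<^sup>2 + H\<^sup>2))) / 2) has_real_derivative
      (s + u * (u / s) + H\<^sup>2 * (1 / s)) / 2) (at u)"
    using DERIV_cdivide[OF DERIV_add[OF DERIV_mult[OF DERIV_ident ds] DERIV_cmult[OF da']], of "H\<^sup>2" 2]
    by (simp add: s_def mult.commute)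
  moreover have "(s + u * (u / s) + H\<^sup>2 * (1 / s)) / 2 = s"
    using s by (simp add: field_simps power2_eq_square)
  ultimately show ?thesis by (simp only: s_def)
qed

text \<open>
  Since \<open>alpha_dat\<close> is a quotient with denominator \<open>D_check\<close>, this sign lets the hypothesis
  \<open>\<alpha>x < alpha_dat\<close> be multiplied out.
\<close>

lemma D_check_pos:
  assumes "W > 0" "H > 0" "vmax > 0" "B > 0"
  shows "D_check W H vmax B > 0"
proof -
  have W_less: "W < sqrt (W\<^sup>2 + H\<^sup>2)"
    using assms by (intro real_less_rsqrt) simp
  then have "0 < W / sqrt (W\<^sup>2 + H\<^sup>2)" "W / sqrt (W\<^sup>2 + H\<^sup>2) < 1"
    using assms(1) less_trans[OF assms(1) W_less]
    by (simp_all only: divide_less_eq_1_pos divide_pos_pos)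
  then have "artanh (W / sqrt (W\<^sup>2 + H\<^sup>2)) > 0"
    by (simp add: artanh_def)
  then show ?thesis
    unfolding D_check_def using assms by (intro mult_pos_pos add_pos_pos divide_pos_pos)
      (auto intro: add_pos_pos)
qed

lemma transferred_data_traj_x_ge:
  assumes "W > 0" "H > 0" "vmax > 0" "B > 0" "Pt > 0" "lam > 0" "sigmasq > 0"
  shows "B * log 2 (Pt * lam\<^sup>2 / (16 * pi\<^sup>2 * sigmasq)) * (W / vmax) - D_hat W H vmax B
      - \<alpha> * D_check W H vmax B
    \<le> transferred_data (W / vmax) (user_rate W H B Pt lam sigmasq (traj_x vmax \<alpha>))"
proof -
  define c where "c = ln (Pt * lam\<^sup>2 / (16 * pi\<^sup>2 * sigmasq))"
  define G where "G = (\<lambda>u::real. u * ln (u\<^sup>2 + H\<^sup>2) - 2 * u + 2 * H * arctan (u / H))"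
  define S where "S = (\<lambda>u::real. (u * sqrt (u\<^sup>2 + H\<^sup>2) + H\<^sup>2 * artanh (u / sqrt (u\<^sup>2 + H\<^sup>2))) / 2)"
  define \<phi> where "\<phi> = (\<lambda>u. B * (c - ln (u\<^sup>2 + H\<^sup>2) - \<alpha> * ln 10 / 10 * sqrt (u\<^sup>2 + H\<^sup>2)) / ln 2)"
  define \<Phi> where "\<Phi> = (\<lambda>u. B * (c * u - G u - \<alpha> * ln 10 / 10 * S u) / ln 2)"
  have dG: "(G has_real_derivative ln (u\<^sup>2 + H\<^sup>2)) (at u)" for u
    unfolding G_def by (rule DERIV_primitive_ln_sum_squares[OF assms(2)])
  have dS: "(S has_real_derivative sqrt (u\<^sup>2 + H\<^sup>2)) (at u)" for u
    unfolding S_def by (rule DERIV_primitive_sqrt_sum_squares[OF assms(2)])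
  have d\<Phi>: "(\<Phi> has_real_derivative \<phi> u) (at u)" for u
    unfolding \<Phi>_def \<phi>_def by (rule derivative_eq_intros dG dS refl | simp)+
  \<comment> \<open>The substitution \<open>u = W - vmax * t\<close>, carried out on the primitive instead of the integral.\<close>
  have dt: "((\<lambda>t. - \<Phi> (W - vmax * t) / vmax) has_real_derivative \<phi> (W - vmax * t)) (at t)" for t
  proof -
    have "((\<lambda>t. W - vmax * t) has_real_derivative - vmax) (at t)"
      by (auto intro!: derivative_eq_intros)
    from DERIV_cdivide[OF DERIV_minus[OF DERIV_chain2[OF d\<Phi> this]], of vmax]
    show ?thesis using assms by simp
  qed
  have "((\<lambda>t. \<phi> (W - vmax * t)) has_integral
      - \<Phi> (W - vmax * (W / vmax)) / vmax - (- \<Phi> (W - vmax * 0) / vmax)) {0..W / vmax}"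
  proof (rule fundamental_theorem_of_calculus)
    show "0 \<le> W / vmax" using assms by simp
    show "((\<lambda>t. - \<Phi> (W - vmax * t) / vmax) has_vector_derivative \<phi> (W - vmax * t))
        (at t within {0..W / vmax})" for t
      using dt[of t]
      by (simp add: has_real_derivative_iff_has_vector_derivative has_vector_derivative_at_within)
  qed
  moreover have "\<Phi> 0 = 0" by (simp add: \<Phi>_def G_def S_def)
  ultimately have lower: "((\<lambda>t. \<phi> (W - vmax * t)) has_integral \<Phi> W / vmax) {0..W / vmax}"
    using assms by simp
  have "user_rate W H B Pt lam sigmasq (traj_x vmax \<alpha>) integrable_on {0..W / vmax}"
    using assms by (intro integrable_continuous_real continuous_on_user_rate_traj_x)
  then have "\<Phi> W / vmax
      \<le> transferred_data (W / vmax) (user_rate W H B Pt lam sigmasq (traj_x vmax \<alpha>))"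
    unfolding transferred_data_def
  proof (intro has_integral_le[OF lower integrable_integral])
    fix t
    have "(W - vmax * t)\<^sup>2 + H\<^sup>2 > 0" using assms by (intro add_nonneg_pos) auto
    then show "\<phi> (W - vmax * t) \<le> user_rate W H B Pt lam sigmasq (traj_x vmax \<alpha>) t"
      using link_rate_ge_log_snr[of B Pt lam sigmasq "sqrt ((W - vmax * t)\<^sup>2 + H\<^sup>2)" \<alpha>] assms
      by (simp add: user_rate_traj_x \<phi>_def c_def)
  qed
  moreover have "\<Phi> W / vmax = B * log 2 (Pt * lam\<^sup>2 / (16 * pi\<^sup>2 * sigmasq)) * (W / vmax)
      - D_hat W H vmax B - \<alpha> * D_check W H vmax B"
  proof -
    have hat: "D_hat W H vmax B = B * G W / (ln 2 * vmax)"
      using assms by (simp add: D_hat_def G_def log_def field_simps)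
    have check: "D_check W H vmax B = B * (ln 10 / 10) * S W / (ln 2 * vmax)"
      using assms by (simp add: D_check_def S_def log_def)
    have "log 2 (Pt * lam\<^sup>2 / (16 * pi\<^sup>2 * sigmasq)) = c / ln 2"
      by (simp add: c_def log_def)
    then show ?thesis
      unfolding hat check \<Phi>_def using assms by (simp add: field_simps)
  qed
  ultimately show ?thesis by simp
qed

section \<open>Comparison of the two trajectories\<close>

theorem theorem3:
  fixes W H vmax B Pt lam sigmasq rmin \<alpha>x :: real
  assumes "W > H" and "H > 0"
    and "vmax > 0" and "B > 0" and "Pt > 0" and "lam > 0" and "sigmasq > 0"
    and "rmin > 0" and "\<alpha>x > 0"
    and "rmin \<le> B * log 2 (1 + Pt * lam\<^sup>2 / (16 * pi\<^sup>2 * sigmasq * W\<^sup>2))"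
    and "alpha_ttc W H B Pt lam sigmasq rmin < \<alpha>x"
    and "\<alpha>x < alpha_dat W H vmax B Pt lam sigmasq"
  shows "(\<forall>T. is_arg_min (\<lambda>T. connection_time (W / vmax) rmin (user_rate W H B Pt lam sigmasq T))
                (\<lambda>T. T \<in> {traj_x vmax \<alpha>x, traj_y vmax H}) T
              \<longleftrightarrow> T = traj_y vmax H)
       \<and> (\<forall>T. is_arg_max (\<lambda>T. transferred_data (W / vmax) (user_rate W H B Pt lam sigmasq T))
                (\<lambda>T. T \<in> {traj_x vmax \<alpha>x, traj_y vmax H}) T
              \<longleftrightarrow> T = traj_x vmax \<alpha>x)"
proof -
  let ?rx = "user_rate W H B Pt lam sigmasq (traj_x vmax \<alpha>x)"
  let ?ry = "user_rate W H B Pt lam sigmasq (traj_y vmax H)"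
  have W: "W > 0" using assms by linarith

  have ttc: "connection_time (W / vmax) rmin ?ry < connection_time (W / vmax) rmin ?rx"
  proof -
    have "sqrt ((H - W)\<^sup>2 + H\<^sup>2) > 0" "(H - W)\<^sup>2 + H\<^sup>2 \<ge> 0"
      using assms by (auto intro!: add_nonneg_pos)
    then have "link_rate B Pt lam sigmasq (ereal \<alpha>x) (sqrt ((H - W)\<^sup>2 + H\<^sup>2)) < rmin"
      using assms by (subst link_rate_less_iff) (auto simp: alpha_ttc_def)
    then have "?rx (H / vmax) < rmin"
      using assms by (simp add: user_rate_traj_x power2_commute[of W])
    moreover have "isCont ?rx (H / vmax)"
      using continuous_on_user_rate_traj_x[of Pt lam sigmasq H UNIV] assms
      by (simp add: continuous_on_eq_continuous_at)
    moreover have "H / vmax < W / vmax"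
      using assms by (simp add: divide_strict_right_mono)
    ultimately have "ereal (H / vmax) < connection_time (W / vmax) rmin ?rx"
      using assms by (intro connection_time_greater user_rate_traj_x_mono) auto
    then show ?thesis using assms by (simp add: connection_time_traj_y)
  qed

  have dat: "transferred_data (W / vmax) ?ry < transferred_data (W / vmax) ?rx"
  proof -
    have "\<alpha>x * D_check W H vmax B
        < B * log 2 (Pt * lam\<^sup>2 / (16 * pi\<^sup>2 * sigmasq)) * (W / vmax)
          - B * log 2 (1 + Pt * lam\<^sup>2 / (16 * pi\<^sup>2 * sigmasq * W\<^sup>2)) * ((W - H) / vmax)
          - D_hat W H vmax B"
      using assms(12) D_check_pos[OF W assms(2,3,4)]
      unfolding alpha_dat_def by (simp add: pos_less_divide_eq)
    then show ?thesis
      using transferred_data_traj_x_ge[OF W assms(2-7), of \<alpha>x] assms(1-3)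
      by (simp add: transferred_data_traj_y)
  qed

  show ?thesis
    using ttc dat unfolding is_arg_min_def is_arg_max_def by (auto dest: less_asym)
qed

end
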